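(* Let $k\ge 1$ and let $1\leq n_1 \leq \ldots \leq n_k$ be integers with $n_k>1$, and let $n = \sum_{i=1}^{k} n_i$. Then the toughness of the complete multipartite graph $K_{n_1,\ldots,n_k}$ is given by \[\tau(K_{n_1,\ldots,n_k})=\frac{n}{n_k}-1.\]
   Context: All graphs are finite, simple, and undirected. $K_{n_1,\ldots,n_k}$ is the graph whose vertex set is partitioned into $k$ parts $V_1,\ldots,V_k$ with $|V_i|=n_i$, in which two distinct vertices are adjacent if and only if they belong to different parts. For a graph $H$, $c(H)$ denotes the number of connected components of $H$. A set $S\subseteq V(G)$ is a separator of $G$ if $c(G-S)\ge 2$. The toughness $\tau(G)$ of a graph $G$ is the minimum of $|S|/c(G-S)$ over all separators $S$ of $G$ (including $S=\emptyset$ if $G$ is disconnected, in which case $\tau(G)=0$), with $\tau(G)=\infty$ if $G$ is complete. *)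

theory Defs
  imports
    "Graph_Theory.Graph_Theory"
    "HOL-Library.Extended_Real"
    "HOL-Library.Disjoint_Sets"
begin

text \<open>
  As in the entry Graph Theory, a finite simple undirected graph is a finite symmetric digraph
  without loops and parallel arcs (\<^locale>\<open>graph\<close>): each edge is a pair of opposite arcs.
  For such a graph the strongly connected components \<^const>\<open>pre_digraph.sccs\<close> are
  exactly the connected components.
\<close>

definition num_components :: "('a, 'b) pre_digraph \<Rightarrow> nat" where
  "num_components G = card (pre_digraph.sccs G)"

definition delete_verts :: "('a, 'b) pre_digraph \<Rightarrow> 'a set \<Rightarrow> ('a, 'b) pre_digraph" where
  "delete_verts G S = induce_subgraph G (verts G - S)"

definition separator :: "('a, 'b) pre_digraph \<Rightarrow> 'a set \<Rightarrow> bool" where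
  "separator G S \<longleftrightarrow> S \<subseteq> verts G \<and> num_components (delete_verts G S) \<ge> 2"

text \<open>
  A finite graph that is not complete has a separator, so the minimum is over a finite
  nonempty set.
\<close>

definition toughness :: "('a, 'b) pre_digraph \<Rightarrow> ereal" where
  "toughness G =
     (if complete_digraph (card (verts G)) G then \<infinity>
      else ereal (Min ((\<lambda>S. real (card S) / real (num_components (delete_verts G S)))
                        ` {S. separator G S})))"

text \<open>
  \<open>G\<close> is a copy of the complete multipartite graph with part sizes \<open>ns ! 0, ns ! 1, \<dots>\<close>
  (parts are indexed from 0).
\<close>

definition complete_multipartite_digraph :: "nat list \<Rightarrow> ('a, 'b) pre_digraph \<Rightarrow> bool" where
  "complete_multipartite_digraph ns G \<longleftrightarrow> graph G \<and>
     (\<exists>V. verts G = (\<Union>i<length ns. V i) \<and>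
          disjoint_family_on V {..<length ns} \<and>
          (\<forall>i<length ns. card (V i) = ns ! i) \<and>
          arcs_ends G = {(u, v). \<exists>i<length ns. \<exists>j<length ns. i \<noteq> j \<and> u \<in> V i \<and> v \<in> V j})"

lemma complete_multipartite_digraph_exists:
  "\<exists>G :: (nat \<times> nat, (nat \<times> nat) \<times> (nat \<times> nat)) pre_digraph. complete_multipartite_digraph ns G"
proof -
  define V where "V i = {i} \<times> {..<ns ! i}" for i
  define W where "W = (\<Union>i<length ns. V i)"
  define A where "A = {(u, v). \<exists>i<length ns. \<exists>j<length ns. i \<noteq> j \<and> u \<in> V i \<and> v \<in> V j}"
  define G where "G = with_proj \<lparr>pverts = W, parcs = A\<rparr>"
  have "finite W" by (auto simp: W_def V_def)
  moreover have AW: "A \<subseteq> W \<times> W" by (auto simp: A_def W_def)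
  ultimately have "finite A" by (meson finite_SigmaI finite_subset)
  have "pair_graph \<lparr>pverts = W, parcs = A\<rparr>"
  proof
    show "symmetric (with_proj \<lparr>pverts = W, parcs = A\<rparr>)"
      unfolding symmetric_def by (auto simp: A_def intro!: symI)
  qed (use AW \<open>finite W\<close> \<open>finite A\<close> in \<open>auto simp: A_def V_def W_def\<close>)
  then have "graph G"
    unfolding G_def by (rule pair_graph.pair_graphD_graph)
  then have "complete_multipartite_digraph ns G"
    unfolding complete_multipartite_digraph_def
    by (intro conjI exI[of _ V])
       (auto simp: G_def W_def A_def V_def disjoint_family_on_def card_cartesian_product_singleton)
  then show ?thesis by blast
qed

end

theory Submission
  imports Defs
begin

text \<open>
  Deleting a set \<open>S\<close> of vertices from a complete multipartite graph leaves a complete multipartite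
  graph on the remaining set \<open>R\<close>. If \<open>R\<close> meets two parts, then what is left is connected: vertices
  of different parts are adjacent, and vertices of the same part have a common neighbour in any
  other part that \<open>R\<close> meets. Hence \<open>S\<close> can only be a separator if \<open>R\<close> lies inside one part, and
  then there are no edges left, so that every vertex of \<open>R\<close> is a component of its own
  (lemma \<open>separator_iff\<close>). The quotient in the definition of toughness is therefore
  \<open>(n - r) / r = n / r - 1\<close> with \<open>r = \<bar>R\<bar> \<ge> 2\<close>. It decreases in \<open>r\<close>, so the minimum is reached
  by keeping exactly a largest part; that part has at least two vertices, so its complement is
  indeed a separator (lemma \<open>toughness_eq\<close>).
\<close>

section \<open>Counting components\<close>

lemma (in wf_digraph) num_components_strongly_connected:
  assumes "strongly_connected G"
  shows "num_components G = 1"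
proof -
  have "sccs_verts = {verts G}"
  proof (intro equalityI subsetI)
    fix T assume T: "T \<in> sccs_verts"
    then have "T \<noteq> {}" "T \<subseteq> verts G"
      by (auto simp: in_sccs_verts_conv_reachable dest: reachable_in_verts)
    then have "verts G \<subseteq> T"
      using T assms unfolding in_sccs_verts_conv_reachable strongly_connected_def by blast
    with \<open>T \<subseteq> verts G\<close> show "T \<in> {verts G}" by simp
  next
    fix T assume "T \<in> {verts G}"
    then show "T \<in> sccs_verts"
      using assms
      by (auto simp: in_sccs_verts_conv_reachable strongly_connected_def dest: reachable_in_verts)
  qed
  then show ?thesis
    by (simp add: num_components_def card_sccs_verts[symmetric])
qed

lemma (in wf_digraph) num_components_edgeless:
  assumes "arcs_ends G = {}"
  shows "num_components G = card (verts G)"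
proof -
  have reach: "u \<rightarrow>\<^sup>* v \<longleftrightarrow> u = v \<and> u \<in> verts G" for u v
    using assms by (auto simp: reachable_conv)
  have "sccs_verts = (\<lambda>v. {v}) ` verts G"
    unfolding sccs_verts_def reach by fast
  then have "card sccs_verts = card (verts G)"
    by (simp add: card_image)
  then show ?thesis
    by (simp add: num_components_def card_sccs_verts)
qed

lemma arcs_ends_induce_subgraph:
  "arcs_ends (induce_subgraph G R) = arcs_ends G \<inter> R \<times> R"
  by (auto simp: arcs_ends_def arc_to_ends_def)

section \<open>Separators of complete multipartite graphs\<close>

locale complete_multipartite = graph G for G :: "('a, 'b) pre_digraph" (structure) +
  fixes I :: "'i set" and V :: "'i \<Rightarrow> 'a set"
  assumes verts_eq: "verts G = (\<Union>i\<in>I. V i)"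
    and disjoint_parts: "disjoint_family_on V I"
    and arcs_ends_eq: "arcs_ends G = {(u, v). \<exists>i\<in>I. \<exists>j\<in>I. i \<noteq> j \<and> u \<in> V i \<and> v \<in> V j}"
begin

lemma part_unique: "u \<in> V i \<Longrightarrow> u \<in> V j \<Longrightarrow> i \<in> I \<Longrightarrow> j \<in> I \<Longrightarrow> i = j"
  using disjoint_parts by (auto simp: disjoint_family_on_def)

lemma num_components_within_part:
  assumes "i \<in> I" "R \<subseteq> V i"
  shows "num_components (induce_subgraph G R) = card R"
proof -
  have "R \<subseteq> verts G"
    using assms by (auto simp: verts_eq)
  then interpret H: wf_digraph "induce_subgraph G R" by blast
  have "arcs_ends (induce_subgraph G R) = {}"
    unfolding arcs_ends_induce_subgraph arcs_ends_eq
    using part_unique[OF _ _ _ assms(1)] assms(2) by blast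
  then show ?thesis
    using H.num_components_edgeless by simp
qed

lemma num_components_across_parts:
  assumes R: "R \<subseteq> verts G"
    and ij: "i \<in> I" "j \<in> I" "i \<noteq> j"
    and a: "a \<in> R" "a \<in> V i" and b: "b \<in> R" "b \<in> V j"
  shows "num_components (induce_subgraph G R) = 1"
proof -
  interpret H: wf_digraph "induce_subgraph G R" using R by blast
  have adj: "u \<rightarrow>\<^bsub>induce_subgraph G R\<^esub> v"
    if "u \<in> R" "v \<in> R" "k \<in> I" "l \<in> I" "k \<noteq> l" "u \<in> V k" "v \<in> V l" for u v k l
    using that by (auto simp: arcs_ends_induce_subgraph arcs_ends_eq)
  have "strongly_connected (induce_subgraph G R)"
  proof (rule strongly_connectedI)
    show "verts (induce_subgraph G R) \<noteq> {}" using a by auto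
  next
    fix u v assume "u \<in> verts (induce_subgraph G R)" "v \<in> verts (induce_subgraph G R)"
    then have uv: "u \<in> R" "v \<in> R" by auto
    then obtain k l where kl: "k \<in> I" "u \<in> V k" "l \<in> I" "v \<in> V l"
      using R unfolding verts_eq by blast
    show "u \<rightarrow>\<^sup>*\<^bsub>induce_subgraph G R\<^esub> v"
    proof (cases "k = l")
      case False
      then show ?thesis using adj uv kl by blast
    next
      case True
      \<comment> \<open>One of \<open>a\<close> and \<open>b\<close> lies outside the common part of \<open>u\<close> and \<open>v\<close>.\<close>
      obtain w m where w: "w \<in> R" "m \<in> I" "w \<in> V m" "m \<noteq> k"
        using ij a b by metis
      have "u \<rightarrow>\<^bsub>induce_subgraph G R\<^esub> w"
        using adj[of u w k m] uv kl w by auto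
      moreover have "w \<rightarrow>\<^bsub>induce_subgraph G R\<^esub> v"
        using adj[of w v m l] uv kl w True by auto
      ultimately show ?thesis
        using H.reachable_trans H.reachable_adjI by blast
    qed
  qed
  then show ?thesis by (rule H.num_components_strongly_connected)
qed

text \<open>
  If two of the remaining vertices lie in different parts, then the remaining graph is connected.
  If they all lie in one part, then the components are single vertices, and
  having at least two components means that at least two vertices remain.
\<close>

lemma separator_iff:
  "separator G S \<longleftrightarrow>
    S \<subseteq> verts G \<and> card (verts G - S) \<ge> 2 \<and> (\<exists>i\<in>I. verts G - S \<subseteq> V i)"
proof (cases "\<exists>i\<in>I. verts G - S \<subseteq> V i")
  case True
  then show ?thesis
    by (auto simp: separator_def delete_verts_def num_components_within_part)
next
  case False
  have "\<not> separator G S"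
  proof
    assume sep: "separator G S"
    have "verts G - S \<noteq> {}"
    proof
      assume "verts G - S = {}"
      then have "num_components (delete_verts G S) = num_components (induce_subgraph G {})"
        by (simp only: delete_verts_def)
      also have "\<dots> = 0"
        using wf_digraph.num_components_edgeless[OF wellformed_induce_subgraph, of "{}"]
        by (simp add: arcs_ends_induce_subgraph)
      finally have "num_components (delete_verts G S) = 0" .
      then show False using sep by (simp add: separator_def)
    qed
    then obtain a i where a: "a \<in> verts G - S" "i \<in> I" "a \<in> V i"
      by (auto simp: verts_eq)
    with False obtain b where b: "b \<in> verts G - S" "b \<notin> V i" by blast
    then obtain j where "j \<in> I" "b \<in> V j" by (auto simp: verts_eq)
    with a b have "num_components (delete_verts G S) = 1"
      unfolding delete_verts_def
      by (intro num_components_across_parts[of _ i j a b]) auto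
    then show False using sep by (simp add: separator_def)
  qed
  with False show ?thesis by blast
qed

lemma num_components_separator:
  "separator G S \<Longrightarrow> num_components (delete_verts G S) = card (verts G - S)"
  by (auto simp: separator_iff delete_verts_def num_components_within_part)

section \<open>Toughness\<close>

lemma not_complete_digraph:
  assumes "i \<in> I" "card (V i) \<ge> 2"
  shows "\<not> complete_digraph n G"
proof
  assume "complete_digraph n G"
  then have ends: "arcs_ends G = {(u, v). (u, v) \<in> verts G \<times> verts G \<and> u \<noteq> v}"
    by (simp add: complete_digraph_def)
  have "\<not> card (V i) \<le> Suc 0" using assms by simp
  moreover from assms have "finite (V i)"
    using card.infinite by fastforce
  ultimately obtain u v where uv: "u \<in> V i" "v \<in> V i" "u \<noteq> v"
    by (auto simp: card_le_Suc0_iff_eq)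
  then have "(u, v) \<in> arcs_ends G"
    using assms by (auto simp: ends verts_eq)
  then show False
    using uv assms part_unique unfolding arcs_ends_eq by blast
qed

text \<open>
  By \<open>separator_iff\<close>, every separator \<open>S\<close> contributes the quotient \<open>n / r - 1\<close>, where
  \<open>r\<close> is the number of vertices that remain; since these lie in one part, \<open>r\<close> is at most the
  size of a largest part \<open>V l\<close>, and deleting everything outside \<open>V l\<close> attains this bound.
\<close>

lemma toughness_eq:
  assumes l: "l \<in> I" "card (V l) \<ge> 2"
    and largest: "\<And>i. i \<in> I \<Longrightarrow> card (V i) \<le> card (V l)"
  shows "toughness G = ereal (real (card (verts G)) / real (card (V l)) - 1)"
proof -
  let ?n = "real (card (verts G))"
  let ?q = "\<lambda>S. real (card S) / real (num_components (delete_verts G S))"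
  have fin: "finite (verts G)" by simp
  have V_sub: "V i \<subseteq> verts G" if "i \<in> I" for i
    using that by (auto simp: verts_eq)
  have q: "?q S = ?n / real (card (verts G - S)) - 1" if "separator G S" for S
  proof -
    have S: "S \<subseteq> verts G" and pos: "card (verts G - S) \<ge> 2"
      using that by (auto simp: separator_iff)
    have "finite S" using S fin by (rule finite_subset)
    then have "card (verts G - S) = card (verts G) - card S" "card S \<le> card (verts G)"
      using S fin by (simp_all add: card_Diff_subset card_mono)
    then have "real (card S) = ?n - real (card (verts G - S))" by simp
    moreover have "real (card (verts G - S)) \<noteq> 0"
      using pos by linarith
    ultimately show ?thesis
      by (simp only: num_components_separator[OF that] diff_divide_distrib divide_self
          not_False_eq_True)
  qed
  let ?S = "verts G - V l"
  have R: "verts G - ?S = V l" using V_sub[OF l(1)] by blast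
  have sep: "separator G ?S"
    using l R by (auto simp: separator_iff)
  have "Min (?q ` {S. separator G S}) = ?n / real (card (V l)) - 1"
  proof (rule Min_eqI)
    have "{S. separator G S} \<subseteq> Pow (verts G)"
      by (auto simp: separator_def)
    then show "finite (?q ` {S. separator G S})"
      using fin by (meson finite_Pow_iff finite_imageI finite_subset)
  next
    show "?n / real (card (V l)) - 1 \<in> ?q ` {S. separator G S}"
      using sep q[OF sep] R by (intro image_eqI[of _ _ ?S]) simp_all
  next
    fix y assume "y \<in> ?q ` {S. separator G S}"
    then obtain S where S: "separator G S" and y: "y = ?q S" by blast
    then obtain i where i: "i \<in> I" "verts G - S \<subseteq> V i" and pos: "card (verts G - S) \<ge> 2"
      by (auto simp: separator_iff)
    have "card (verts G - S) \<le> card (V i)"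
      using i V_sub fin by (meson card_mono finite_subset)
    also have "\<dots> \<le> card (V l)" using largest i by blast
    finally have "?n / real (card (V l)) \<le> ?n / real (card (verts G - S))"
      using pos by (intro divide_left_mono) (auto simp: zero_less_mult_iff)
    then show "?n / real (card (V l)) - 1 \<le> y"
      unfolding y q[OF S] by simp
  qed
  then show ?thesis
    using not_complete_digraph[OF l] by (simp add: toughness_def)
qed

end

theorem proposition4p16:
  fixes ns :: "nat list" and G :: "('a, 'b) pre_digraph"
  assumes "length ns \<ge> 1"
    and "1 \<le> hd ns" and "sorted ns" and "last ns > 1"
    and "complete_multipartite_digraph ns G"
  shows "toughness G = ereal (real (sum_list ns) / real (last ns) - 1)"
proof -
  let ?I = "{..<length ns}" and ?l = "length ns - 1"
  obtain V where "graph G"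
    and verts: "verts G = (\<Union>i\<in>?I. V i)"
    and disj: "disjoint_family_on V ?I"
    and card_V: "\<forall>i<length ns. card (V i) = ns ! i"
    and ends: "arcs_ends G = {(u, v). \<exists>i<length ns. \<exists>j<length ns. i \<noteq> j \<and> u \<in> V i \<and> v \<in> V j}"
    using assms(5) unfolding complete_multipartite_digraph_def by auto
  interpret graph G by fact
  interpret complete_multipartite G ?I V
    by unfold_locales (use verts disj in \<open>auto simp: ends\<close>)
  have last: "last ns = ns ! ?l" and l: "?l < length ns"
    using assms(1) last_conv_nth[of ns] by (cases ns; simp)+
  have "finite (V i)" if "i \<in> ?I" for i
    using that by (intro finite_subset[OF _ finite_verts]) (auto simp: verts)
  then have "card (verts G) = (\<Sum>i\<in>?I. card (V i))"
    unfolding verts using disj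
    by (intro card_UN_disjoint) (auto simp: disjoint_family_on_def)
  also have "\<dots> = sum_list ns"
    using card_V by (simp add: sum_list_sum_nth atLeast0LessThan)
  finally have n: "card (verts G) = sum_list ns" .
  have "card (V i) \<le> card (V ?l)" if "i \<in> ?I" for i
    using that card_V l assms(3) by (auto intro: sorted_nth_mono)
  then show ?thesis
    using toughness_eq[of ?l] card_V l assms(4) by (simp add: n last)
qed

end
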